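(* Let $\mathbf{A}=(A,(f_{\alpha})_{\alpha\in I})$ be an algebra (a set $A$ with a family of operations $f_\alpha:A^{n_\alpha}\to A$ of finite arity), and let $\mathscr{C}$ be a nonempty set of congruences of $\mathbf{A}$ such that $(\mathscr{C},\subseteq)$ is down-directed. Then $\mathscr{C}$ is a base for a uniformity on $A$, and the topology $\mathcal{T}$ associated with this uniformity makes $(A,(f_{\alpha})_{\alpha\in I},\mathcal{T})$ a topological algebra.
   Context: A poset is down-directed if any two of its elements have a lower bound in it. A nonempty set $\mathcal B$ of subsets of $A\times A$ is a base for a uniformity $\mathcal U$ on $A$ if $\mathcal B\subseteq\mathcal U$ and every entourage in $\mathcal U$ contains a member of $\mathcal B$. For $R\subseteq A\times A$ and $y\in A$, $R[y]=\{x\in A:(x,y)\in R\}$. The topology associated with a uniformity $\mathcal U$: a set $\Omega\subseteq A$ is open iff for each $x\in\Omega$ there is $V\in\mathcal U$ with $V[x]\subseteq\Omega$. A topological algebra is an algebra with a topology $\mathcal T$ such that each operation $f_\alpha:(A,\mathcal T)^{n_\alpha}\to(A,\mathcal T)$ is continuous for the product topology on $A^{n_\alpha}$. *)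

theory Defs
  imports "HOL-Analysis.Abstract_Topology" "HOL-Analysis.Product_Topology" "HOL-Analysis.Function_Topology"
begin

text \<open>
  An algebra is given by a carrier \<open>A\<close>, a set \<open>I\<close> of operation symbols, their arities \<open>ar\<close>
  and the operations \<open>f\<close>. The power \<open>A\<close> to the \<open>n\<close> is the extensional function space
  \<open>{..<n} \<rightarrow>\<^sub>E A\<close>, which is also the underlying set of the library's product topology.
  The carrier may be empty and nullary operations are allowed.
\<close>

definition universal_algebra ::
    "'a set \<Rightarrow> 'i set \<Rightarrow> ('i \<Rightarrow> nat) \<Rightarrow> ('i \<Rightarrow> (nat \<Rightarrow> 'a) \<Rightarrow> 'a) \<Rightarrow> bool" where
  "universal_algebra A I ar f \<longleftrightarrow> (\<forall>\<alpha>\<in>I. f \<alpha> \<in> ({..<ar \<alpha>} \<rightarrow>\<^sub>E A) \<rightarrow> A)"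

definition congruence_of ::
    "'a set \<Rightarrow> 'i set \<Rightarrow> ('i \<Rightarrow> nat) \<Rightarrow> ('i \<Rightarrow> (nat \<Rightarrow> 'a) \<Rightarrow> 'a) \<Rightarrow> ('a \<times> 'a) set \<Rightarrow> bool" where
  "congruence_of A I ar f \<theta> \<longleftrightarrow>
     equiv A \<theta> \<and>
     (\<forall>\<alpha>\<in>I. \<forall>x\<in>{..<ar \<alpha>} \<rightarrow>\<^sub>E A. \<forall>y\<in>{..<ar \<alpha>} \<rightarrow>\<^sub>E A.
        (\<forall>i<ar \<alpha>. (x i, y i) \<in> \<theta>) \<longrightarrow> (f \<alpha> x, f \<alpha> y) \<in> \<theta>)"

definition down_directed :: "'a::order set \<Rightarrow> bool" where
  "down_directed P \<longleftrightarrow> (\<forall>x\<in>P. \<forall>y\<in>P. \<exists>z\<in>P. z \<le> x \<and> z \<le> y)"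

text \<open>
  Uniformities on an arbitrary carrier set, presented by their entourages; the library's
  \<^class>\<open>uniform_space\<close> only covers a uniformity fixed on a whole type. Properness of the filter is
  not required separately: entourages contain the diagonal, so it is automatic unless \<open>A\<close> is empty.
\<close>

definition uniformity_of :: "'a set \<Rightarrow> ('a \<times> 'a) set set \<Rightarrow> bool" where
  "uniformity_of A \<U> \<longleftrightarrow>
     \<U> \<noteq> {} \<and>
     (\<forall>V\<in>\<U>. V \<subseteq> A \<times> A) \<and>
     (\<forall>V\<in>\<U>. \<forall>W. V \<subseteq> W \<and> W \<subseteq> A \<times> A \<longrightarrow> W \<in> \<U>) \<and>
     (\<forall>V\<in>\<U>. \<forall>W\<in>\<U>. V \<inter> W \<in> \<U>) \<and>
     (\<forall>V\<in>\<U>. Id_on A \<subseteq> V) \<and>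
     (\<forall>V\<in>\<U>. V\<inverse> \<in> \<U>) \<and>
     (\<forall>V\<in>\<U>. \<exists>W\<in>\<U>. W O W \<subseteq> V)"

definition uniformity_base :: "('a \<times> 'a) set set \<Rightarrow> ('a \<times> 'a) set set \<Rightarrow> bool" where
  "uniformity_base \<B> \<U> \<longleftrightarrow> \<B> \<noteq> {} \<and> \<B> \<subseteq> \<U> \<and> (\<forall>V\<in>\<U>. \<exists>B\<in>\<B>. B \<subseteq> V)"

definition rel_section :: "'a set \<Rightarrow> ('a \<times> 'a) set \<Rightarrow> 'a \<Rightarrow> 'a set" where
  "rel_section A R y = {x \<in> A. (x, y) \<in> R}"

definition uniformity_topology :: "'a set \<Rightarrow> ('a \<times> 'a) set set \<Rightarrow> 'a topology" where
  "uniformity_topology A \<U> =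
     topology (\<lambda>\<Omega>. \<Omega> \<subseteq> A \<and> (\<forall>x\<in>\<Omega>. \<exists>V\<in>\<U>. rel_section A V x \<subseteq> \<Omega>))"

text \<open>The constructor \<^const>\<open>topology\<close> is only meaningful on families closed under finite
  intersections and unions; the next two lemmas show that this is the case for a uniformity.\<close>

lemma openin_uniformity_topology:
  assumes "uniformity_of A \<U>"
  shows "openin (uniformity_topology A \<U>) \<Omega> \<longleftrightarrow>
    \<Omega> \<subseteq> A \<and> (\<forall>x\<in>\<Omega>. \<exists>V\<in>\<U>. rel_section A V x \<subseteq> \<Omega>)"
proof -
  define L where "L = (\<lambda>\<Omega>. \<Omega> \<subseteq> A \<and> (\<forall>x\<in>\<Omega>. \<exists>V\<in>\<U>. rel_section A V x \<subseteq> \<Omega>))"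
  have "L (S \<inter> T)" if S: "L S" and T: "L T" for S T
    unfolding L_def
  proof (intro conjI ballI)
    show "S \<inter> T \<subseteq> A" using S by (auto simp: L_def)
    fix x assume x: "x \<in> S \<inter> T"
    obtain V where V: "V \<in> \<U>" "rel_section A V x \<subseteq> S"
      using S x by (auto simp: L_def)
    obtain W where W: "W \<in> \<U>" "rel_section A W x \<subseteq> T"
      using T x by (auto simp: L_def)
    have "\<forall>V\<in>\<U>. \<forall>W\<in>\<U>. V \<inter> W \<in> \<U>"
      using assms unfolding uniformity_of_def by (elim conjE)
    then have "V \<inter> W \<in> \<U>"
      using V(1) W(1) by simp
    then show "\<exists>V\<in>\<U>. rel_section A V x \<subseteq> S \<inter> T"
      using V(2) W(2) by (intro bexI[of _ "V \<inter> W"]) (auto simp: rel_section_def)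
  qed
  moreover have "L (\<Union>\<K>)" if \<K>: "\<forall>K\<in>\<K>. L K" for \<K>
    unfolding L_def
  proof (intro conjI ballI)
    show "\<Union>\<K> \<subseteq> A" using \<K> by (auto simp: L_def)
    fix x assume "x \<in> \<Union>\<K>"
    then obtain K where K: "K \<in> \<K>" "x \<in> K" by auto
    then have "L K"
      using \<K> by simp
    then obtain V where V: "V \<in> \<U>" "rel_section A V x \<subseteq> K"
      using K by (auto simp: L_def)
    show "\<exists>V\<in>\<U>. rel_section A V x \<subseteq> \<Union>\<K>"
      using V K by (intro bexI[of _ V]) auto
  qed
  ultimately have "istopology L"
    unfolding istopology_def by simp
  then show ?thesis
    by (simp add: uniformity_topology_def L_def)
qed

lemma topspace_uniformity_topology:
  assumes "uniformity_of A \<U>"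
  shows "topspace (uniformity_topology A \<U>) = A"
proof -
  have "\<U> \<noteq> {}"
    using assms unfolding uniformity_of_def by (elim conjE)
  then obtain V where "V \<in> \<U>"
    by auto
  then have "openin (uniformity_topology A \<U>) A"
    unfolding openin_uniformity_topology[OF assms]
    by (intro conjI ballI bexI[of _ V]) (auto simp: rel_section_def)
  then have "A \<subseteq> topspace (uniformity_topology A \<U>)"
    by (rule openin_subset)
  moreover have "topspace (uniformity_topology A \<U>) \<subseteq> A"
    using openin_topspace[of "uniformity_topology A \<U>"]
    unfolding openin_uniformity_topology[OF assms] by (rule conjunct1)
  ultimately show ?thesis by (rule subset_antisym[rotated])
qed

definition topological_algebra ::
    "'a set \<Rightarrow> 'i set \<Rightarrow> ('i \<Rightarrow> nat) \<Rightarrow> ('i \<Rightarrow> (nat \<Rightarrow> 'a) \<Rightarrow> 'a) \<Rightarrow> 'a topology \<Rightarrow> bool" where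
  "topological_algebra A I ar f T \<longleftrightarrow>
     universal_algebra A I ar f \<and> topspace T = A \<and>
     (\<forall>\<alpha>\<in>I. continuous_map (product_topology (\<lambda>_. T) {..<ar \<alpha>}) T (f \<alpha>))"

end

theory Submission
  imports Defs
begin

text \<open>
  An equivalence relation \<open>\<theta>\<close> satisfies \<open>\<theta>\<inverse> = \<theta>\<close> and \<open>\<theta> O \<theta> \<subseteq> \<theta>\<close>, so a down-directed set of them
  generates a uniformity by passing to supersets. By transitivity the blocks of every entourage
  that is an equivalence relation are open, and compatibility of \<open>\<theta>\<close> with an operation says that
  the product of the blocks of the arguments is mapped into the block of the value.
\<close>

lemma uniformity_of_equivs:
  assumes "\<C> \<noteq> {}" and eq: "\<And>\<theta>. \<theta> \<in> \<C> \<Longrightarrow> equiv A \<theta>" and dir: "down_directed \<C>"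
  shows "uniformity_of A {V. V \<subseteq> A \<times> A \<and> (\<exists>\<theta>\<in>\<C>. \<theta> \<subseteq> V)}" (is "uniformity_of A ?\<U>")
proof -
  have sub: "\<theta> \<subseteq> A \<times> A" if "\<theta> \<in> \<C>" for \<theta>
    using eq[OF that] by (rule equiv_type)
  \<comment> \<open>\<open>UI\<close> and \<open>UE\<close> serve as introduction and elimination
    rules for the comprehension, so each axiom reduces to naming a member of \<open>\<C>\<close>
    below the set in question.\<close>
  have UI: "V \<in> ?\<U>" if "V \<subseteq> A \<times> A" "\<theta> \<in> \<C>" "\<theta> \<subseteq> V" for V \<theta>
    using that by blast
  have UE: thesis if "V \<in> ?\<U>" "\<And>\<theta>. V \<subseteq> A \<times> A \<Longrightarrow> \<theta> \<in> \<C> \<Longrightarrow> \<theta> \<subseteq> V \<Longrightarrow> thesis" for V thesis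
    using that by blast
  obtain \<theta>\<^sub>0 where "\<theta>\<^sub>0 \<in> \<C>"
    using assms(1) by blast
  show ?thesis
    unfolding uniformity_of_def
  proof (intro conjI ballI allI impI)
    have "\<theta>\<^sub>0 \<in> ?\<U>"
      using \<open>\<theta>\<^sub>0 \<in> \<C>\<close> sub by (intro UI) auto
    then show "?\<U> \<noteq> {}"
      by (metis empty_iff)
  next
    fix V assume V: "V \<in> ?\<U>"
    then obtain \<theta> where "V \<subseteq> A \<times> A" and \<theta>: "\<theta> \<in> \<C>" "\<theta> \<subseteq> V"
      by (rule UE)
    then show "V \<subseteq> A \<times> A"
      by simp
    have "refl_on A \<theta>" "sym \<theta>" "trans \<theta>"
      using eq[OF \<theta>(1)] by (simp_all add: equiv_def)
    show "Id_on A \<subseteq> V"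
      using \<open>refl_on A \<theta>\<close> \<theta>(2) by (auto dest: refl_onD)
    show "V\<inverse> \<in> ?\<U>"
      using \<open>sym \<theta>\<close> \<open>V \<subseteq> A \<times> A\<close> \<theta> by (intro UI[OF _ \<theta>(1)]) (auto dest: symD)
    \<comment> \<open>The entourage whose square lies in \<open>V\<close> is \<open>\<theta>\<close>
      itself, by transitivity.\<close>
    have "\<theta> \<in> ?\<U>"
      using \<theta>(1) sub by (intro UI) auto
    moreover have "\<theta> O \<theta> \<subseteq> V"
      using trans_O_subset[OF \<open>trans \<theta>\<close>] \<theta>(2) by (rule subset_trans)
    ultimately show "\<exists>W\<in>?\<U>. W O W \<subseteq> V"
      by (rule bexI[rotated])
    show "W \<in> ?\<U>" if "V \<subseteq> W \<and> W \<subseteq> A \<times> A" for W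
      using that \<theta> by (intro UI[OF _ \<theta>(1)]) auto
    fix W assume "W \<in> ?\<U>"
    then obtain \<eta> where \<eta>: "\<eta> \<in> \<C>" "\<eta> \<subseteq> W"
      by (rule UE)
    \<comment> \<open>Directedness replaces closure of \<open>\<C>\<close> under intersection: a
      common lower bound lies below \<open>V \<inter> W\<close>.\<close>
    obtain \<zeta> where "\<zeta> \<in> \<C>" "\<zeta> \<subseteq> \<theta>" "\<zeta> \<subseteq> \<eta>"
      using dir \<theta>(1) \<eta>(1) unfolding down_directed_def by blast
    then show "V \<inter> W \<in> ?\<U>"
      using \<open>V \<subseteq> A \<times> A\<close> \<theta>(2) \<eta>(2) by (intro UI) auto
  qed
qed

text \<open>A section of a general entourage is only a neighbourhood of its centre. Here the single
  entourage \<open>\<theta>\<close> witnesses openness at every point of the block, since the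
  section at any such point stays inside the block.\<close>

lemma openin_rel_section_equiv:
  assumes "uniformity_of A \<U>" "\<theta> \<in> \<U>" "equiv A \<theta>"
  shows "openin (uniformity_topology A \<U>) (rel_section A \<theta> y)"
  unfolding openin_uniformity_topology[OF assms(1)]
proof (intro conjI ballI bexI)
  fix x assume "x \<in> rel_section A \<theta> y"
  with \<open>equiv A \<theta>\<close> show "rel_section A \<theta> x \<subseteq> rel_section A \<theta> y"
    unfolding rel_section_def equiv_def by (blast dest: transD)
qed (use \<open>\<theta> \<in> \<U>\<close> in \<open>auto simp: rel_section_def\<close>)

lemma topological_algebra_uniformity_topology:
  assumes alg: "universal_algebra A I ar f"
    and unif: "uniformity_of A \<U>" and base: "uniformity_base \<C> \<U>"
    and cong: "\<And>\<theta>. \<theta> \<in> \<C> \<Longrightarrow> congruence_of A I ar f \<theta>"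
  shows "topological_algebra A I ar f (uniformity_topology A \<U>)" (is "topological_algebra A I ar f ?T")
proof -
  have top: "topspace ?T = A"
    by (rule topspace_uniformity_topology[OF unif])
  have "continuous_map (product_topology (\<lambda>_. ?T) {..<ar \<alpha>}) ?T (f \<alpha>)"
    (is "continuous_map ?P ?T _") if \<alpha>: "\<alpha> \<in> I" for \<alpha>
    unfolding continuous_map
  proof (intro conjI allI impI)
    have f: "f \<alpha> x \<in> A" if "x \<in> {..<ar \<alpha>} \<rightarrow>\<^sub>E A" for x
      using alg \<alpha> that unfolding universal_algebra_def by blast
    then show "f \<alpha> ` topspace ?P \<subseteq> topspace ?T"
      by (auto simp: top)
    fix \<Omega> assume \<Omega>: "openin ?T \<Omega>"
    show "openin ?P {x \<in> topspace ?P. f \<alpha> x \<in> \<Omega>}"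
    proof (subst openin_subopen, intro ballI)
      fix x assume "x \<in> {x \<in> topspace ?P. f \<alpha> x \<in> \<Omega>}"
      then have x: "x \<in> {..<ar \<alpha>} \<rightarrow>\<^sub>E A" "f \<alpha> x \<in> \<Omega>"
        by (simp_all add: top)
      obtain V where "V \<in> \<U>" "rel_section A V (f \<alpha> x) \<subseteq> \<Omega>"
        using \<Omega> x(2) unfolding openin_uniformity_topology[OF unif] by blast
      \<comment> \<open>Shrinking an entourage shrinks its sections, so \<open>V\<close> may be
        replaced by a congruence from the base.\<close>
      then obtain \<theta> where \<theta>: "\<theta> \<in> \<C>" "rel_section A \<theta> (f \<alpha> x) \<subseteq> \<Omega>"
        using base unfolding uniformity_base_def rel_section_def by blast
      have "\<theta> \<in> \<U>"
        using base \<theta>(1) unfolding uniformity_base_def by blast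
      have eq: "equiv A \<theta>"
        using cong[OF \<theta>(1)] unfolding congruence_of_def by blast
      \<comment> \<open>The neighbourhood of \<open>x\<close> is the box of the blocks of its
        coordinates. It is open because there are finitely many open factors, and it contains
        \<open>x\<close> by reflexivity; for arity 0 it is the whole one-point space.\<close>
      define B where "B = (\<Pi>\<^sub>E i\<in>{..<ar \<alpha>}. rel_section A \<theta> (x i))"
      have "openin ?P B"
        unfolding B_def
        by (simp add: openin_PiE openin_rel_section_equiv[OF unif \<open>\<theta> \<in> \<U>\<close> eq])
      moreover have "x \<in> B"
        using x(1) eq by (auto simp: B_def rel_section_def PiE_iff equiv_def refl_on_def)
      moreover have "B \<subseteq> {x \<in> topspace ?P. f \<alpha> x \<in> \<Omega>}"
      proof
        fix y assume "y \<in> B"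
        then have y: "y \<in> {..<ar \<alpha>} \<rightarrow>\<^sub>E A" "\<forall>i<ar \<alpha>. (y i, x i) \<in> \<theta>"
          by (auto simp: B_def rel_section_def PiE_iff)
        have "(f \<alpha> y, f \<alpha> x) \<in> \<theta>"
          using cong[OF \<theta>(1)] \<alpha> x(1) y unfolding congruence_of_def by blast
        with f[OF y(1)] \<theta>(2) have "f \<alpha> y \<in> \<Omega>"
          by (auto simp: rel_section_def)
        with y(1) show "y \<in> {x \<in> topspace ?P. f \<alpha> x \<in> \<Omega>}"
          by (simp add: top)
      qed
      ultimately show "\<exists>B. openin ?P B \<and> x \<in> B \<and> B \<subseteq> {x \<in> topspace ?P. f \<alpha> x \<in> \<Omega>}"
        by blast
    qed
  qed
  then show ?thesis
    using alg top unfolding topological_algebra_def by blast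
qed

text \<open>A base determines its uniformity, as entourages are closed under supersets within
  \<open>A \<times> A\<close>. The universal second part thus speaks of the one uniformity that the
  first part provides.\<close>

theorem theorem2p8:
  fixes A :: "'a set" and I :: "'i set" and ar :: "'i \<Rightarrow> nat"
    and f :: "'i \<Rightarrow> (nat \<Rightarrow> 'a) \<Rightarrow> 'a" and \<C> :: "('a \<times> 'a) set set"
  assumes "universal_algebra A I ar f"
    and "\<C> \<noteq> {}"
    and "\<forall>\<theta>\<in>\<C>. congruence_of A I ar f \<theta>"
    and "down_directed \<C>"
  shows "(\<exists>\<U>. uniformity_of A \<U> \<and> uniformity_base \<C> \<U>) \<and>
    (\<forall>\<U>. uniformity_of A \<U> \<and> uniformity_base \<C> \<U> \<longrightarrow>
       topological_algebra A I ar f (uniformity_topology A \<U>))"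
proof (intro conjI allI impI)
  let ?\<U> = "{V. V \<subseteq> A \<times> A \<and> (\<exists>\<theta>\<in>\<C>. \<theta> \<subseteq> V)}"
  have eq: "equiv A \<theta>" if "\<theta> \<in> \<C>" for \<theta>
    using assms(3) that unfolding congruence_of_def by blast
  have "uniformity_of A ?\<U>"
    using assms(2) eq assms(4) by (rule uniformity_of_equivs)
  moreover have "uniformity_base \<C> ?\<U>"
    unfolding uniformity_base_def
  proof (intro conjI subsetI)
    \<comment> \<open>Each congruence is a superset of itself inside \<open>A \<times> A\<close>;
      that every entourage contains a member of \<open>\<C>\<close> is built into
      \<open>?\<U>\<close>.\<close>
    show "\<theta> \<in> ?\<U>" if "\<theta> \<in> \<C>" for \<theta>
      using that equiv_type[OF eq[OF that]] by blast
  qed (use assms(2) in simp_all)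
  ultimately show "\<exists>\<U>. uniformity_of A \<U> \<and> uniformity_base \<C> \<U>"
    by blast
next
  fix \<U> assume "uniformity_of A \<U> \<and> uniformity_base \<C> \<U>"
  then show "topological_algebra A I ar f (uniformity_topology A \<U>)"
    using assms(1,3) by (intro topological_algebra_uniformity_topology) auto
qed

end
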